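(* Let $n>1$, let $\Gamma(D_n)$ be the generating graph of the dihedral group $D_n$ and $\Gamma(Q_n)$ the generating graph of the dicyclic group $Q_n$. Let $$\Theta=\left\{\{1,x^{n}\},\{x,x^{n+1}\},\dots,\{x^{n-1},x^{2n-1}\},\{y,y^3\},\{xy,x^{n+1}y\},\dots,\{x^{n-1}y,x^{2n-1}y\}\right\},$$ a partition of the vertex set of $\Gamma(Q_n)$. Then the quotient graph $\Gamma(Q_n)/\Theta$ is isomorphic to the graph $\Gamma(D_n)$.
   Context: For $n\ge 2$, the dicyclic group is $Q_n=\langle x,y : x^{2n}=1,\ x^n=y^2,\ yx=x^{-1}y\rangle$, of order $4n$, with elements $x^a, x^b y$ ($0\le a,b\le 2n-1$); note $y^3=x^ny$. The dihedral group is $D_n=\langle r,s : r^n=s^2=1,\ srs=r^{-1}\rangle$, of order $2n$. The generating graph $\Gamma(G)$ of a group $G$ is the simple undirected graph with vertex set $G$ in which two distinct vertices $g,h$ are adjacent iff $\langle g,h\rangle=G$. For a graph $X$ and a partition $\pi=\{U_1,\dots,U_k\}$ of $V(X)$, the quotient graph $X/\pi$ has the cells $U_i$ as vertices, and for $i\ne j$ the cells $U_i,U_j$ are adjacent iff there exist $a\in U_i$ and $b\in U_j$ adjacent in $X$. *)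

theory Defs
  imports "HOL-Algebra.Generated_Groups" "Graph_Theory.Graph_Theory" "HOL-Library.Disjoint_Sets"
begin

section \<open>Groups given by generators and relations\<close>

text \<open>
  The generators are all the elements of a type. A word is a list of letters \<open>(g, b)\<close>, where
  \<open>(g, True)\<close> stands for \<open>g\<close> and \<open>(g, False)\<close> for the formal inverse of \<open>g\<close>. A relation \<open>u = v\<close>
  is the pair of words \<open>(u, v)\<close>. The presented group is the set of all words modulo the least
  congruence that contains the relations and cancels a letter against its formal inverse.
\<close>

type_synonym 'g word = "('g \<times> bool) list"

inductive pres_eq :: "('g word \<times> 'g word) set \<Rightarrow> 'g word \<Rightarrow> 'g word \<Rightarrow> bool" for R where
  rel: "(u, v) \<in> R \<Longrightarrow> pres_eq R u v"
| cancel: "pres_eq R [(g, b), (g, \<not> b)] []"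
| refl: "pres_eq R u u"
| sym: "pres_eq R u v \<Longrightarrow> pres_eq R v u"
| trans: "pres_eq R u v \<Longrightarrow> pres_eq R v w \<Longrightarrow> pres_eq R u w"
| app: "pres_eq R u v \<Longrightarrow> pres_eq R u' v' \<Longrightarrow> pres_eq R (u @ u') (v @ v')"

definition pres_class :: "('g word \<times> 'g word) set \<Rightarrow> 'g word \<Rightarrow> 'g word set" where
  "pres_class R u = {v. pres_eq R u v}"

definition presented_group :: "('g word \<times> 'g word) set \<Rightarrow> 'g word set monoid" where
  "presented_group R =
    \<lparr>carrier = range (pres_class R),
     monoid.mult = (\<lambda>A B. \<Union>u\<in>A. \<Union>v\<in>B. pres_class R (u @ v)),
     one = pres_class R []\<rparr>"

definition pres_gen :: "('g word \<times> 'g word) set \<Rightarrow> 'g \<Rightarrow> 'g word set" where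
  "pres_gen R g = pres_class R [(g, True)]"

lemma pres_class_eq_iff: "pres_class R u = pres_class R v \<longleftrightarrow> pres_eq R u v"
  unfolding pres_class_def
  by (auto intro: pres_eq.refl pres_eq.sym pres_eq.trans)

lemma pres_mult:
  "pres_class R u \<otimes>\<^bsub>presented_group R\<^esub> pres_class R v = pres_class R (u @ v)"
proof -
  have "pres_class R (u' @ v') = pres_class R (u @ v)"
    if "u' \<in> pres_class R u" "v' \<in> pres_class R v" for u' v'
    using that unfolding pres_class_eq_iff
    by (auto simp: pres_class_def intro: pres_eq.app pres_eq.sym)
  then have "(\<Union>u'\<in>pres_class R u. \<Union>v'\<in>pres_class R v. pres_class R (u' @ v'))
    = (\<Union>u'\<in>pres_class R u. \<Union>v'\<in>pres_class R v. pres_class R (u @ v))"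
    by (intro SUP_cong) simp_all
  moreover have "pres_class R u \<noteq> {}" "pres_class R v \<noteq> {}"
    by (auto simp: pres_class_def intro: pres_eq.refl)
  ultimately show ?thesis
    unfolding presented_group_def by simp
qed

lemma pres_one: "\<one>\<^bsub>presented_group R\<^esub> = pres_class R []"
  by (simp add: presented_group_def)

lemma pres_carrier: "carrier (presented_group R) = range (pres_class R)"
  by (simp add: presented_group_def)

lemma pres_left_inverse: "\<exists>v. pres_eq R (v @ u) []"
proof (induction u)
  case Nil
  show ?case by (auto intro: exI[of _ "[]"] pres_eq.refl)
next
  case (Cons a u)
  obtain g b where a: "a = (g, b)" by (cases a)
  from Cons obtain v where v: "pres_eq R (v @ u) []" by blast
  have "pres_eq R [(g, \<not> b), (g, b)] []"
    using pres_eq.cancel[of R g "\<not> b"] by simp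
  then have "pres_eq R (v @ ([(g, \<not> b), (g, b)] @ u)) (v @ ([] @ u))"
    by (intro pres_eq.app pres_eq.refl)
  then have "pres_eq R ((v @ [(g, \<not> b)]) @ (a # u)) []"
    using v by (auto simp: a intro: pres_eq.trans)
  then show ?case by blast
qed

lemma group_presented_group: "group (presented_group R)"
proof (rule groupI)
  fix x assume "x \<in> carrier (presented_group R)"
  then obtain u where u: "x = pres_class R u" by (auto simp: pres_carrier)
  obtain v where "pres_eq R (v @ u) []" using pres_left_inverse by blast
  then show "\<exists>y\<in>carrier (presented_group R). y \<otimes>\<^bsub>presented_group R\<^esub> x = \<one>\<^bsub>presented_group R\<^esub>"
    unfolding u pres_carrier pres_one
    by (auto simp: pres_mult pres_class_eq_iff)
qed (auto simp: pres_carrier pres_one pres_mult)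

lemma inv_pres_gen: "inv\<^bsub>presented_group R\<^esub> (pres_gen R g) = pres_class R [(g, False)]"
proof -
  interpret group "presented_group R" by (rule group_presented_group)
  have "pres_eq R [(g, False), (g, True)] []"
    using pres_eq.cancel[of R g False] by simp
  then show ?thesis
    by (intro inv_equality) (auto simp: pres_gen_def pres_mult pres_one pres_carrier pres_class_eq_iff)
qed

fun word_val :: "('a, 'm) monoid_scheme \<Rightarrow> ('g \<Rightarrow> 'a) \<Rightarrow> 'g word \<Rightarrow> 'a" where
  "word_val G f [] = \<one>\<^bsub>G\<^esub>"
| "word_val G f ((g, b) # w) = (if b then f g else inv\<^bsub>G\<^esub> (f g)) \<otimes>\<^bsub>G\<^esub> word_val G f w"

lemma word_val_pres_gen: "word_val (presented_group R) (pres_gen R) w = pres_class R w"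
proof (induction w)
  case Nil
  show ?case by (simp add: pres_one)
next
  case (Cons a w)
  then show ?case
    by (cases a) (auto simp: inv_pres_gen, auto simp: pres_gen_def pres_mult)
qed

lemma presented_group_relation:
  assumes "(u, v) \<in> R"
  shows "word_val (presented_group R) (pres_gen R) u = word_val (presented_group R) (pres_gen R) v"
  using assms by (simp add: word_val_pres_gen pres_class_eq_iff pres_eq.rel)

lemma presented_group_generated:
  "generate (presented_group R) (range (pres_gen R)) = carrier (presented_group R)"
proof
  interpret group "presented_group R" by (rule group_presented_group)
  show "generate (presented_group R) (range (pres_gen R)) \<subseteq> carrier (presented_group R)"
    by (rule generate_incl) (auto simp: pres_gen_def pres_carrier)
  have "pres_gen R g \<in> generate (presented_group R) (range (pres_gen R))"
    "inv\<^bsub>presented_group R\<^esub> (pres_gen R g) \<in> generate (presented_group R) (range (pres_gen R))" for g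
    by (rule generate.incl generate.inv, rule rangeI)+
  then have "word_val (presented_group R) (pres_gen R) w
      \<in> generate (presented_group R) (range (pres_gen R))" for w
    by (induction w) (auto intro!: generate.eng intro: generate.one)
  then show "carrier (presented_group R) \<subseteq> generate (presented_group R) (range (pres_gen R))"
    by (auto simp: pres_carrier word_val_pres_gen)
qed

theorem presented_group_universal:
  assumes "group G" and f: "\<And>g. f g \<in> carrier G"
    and R: "\<And>u v. (u, v) \<in> R \<Longrightarrow> word_val G f u = word_val G f v"
  shows "\<exists>h \<in> hom (presented_group R) G. \<forall>g. h (pres_gen R g) = f g"
proof -
  interpret group G by fact
  have closed: "word_val G f w \<in> carrier G" for w
    by (induction w) (auto simp: f)
  have app: "word_val G f (u @ v) = word_val G f u \<otimes>\<^bsub>G\<^esub> word_val G f v" for u v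
    by (induction u) (auto simp: f closed m_assoc)
  have resp: "word_val G f u = word_val G f v" if "pres_eq R u v" for u v
    using that
  proof induction
    case (cancel g b)
    then show ?case using f by (cases b) auto
  qed (auto simp: R app)
  define h where "h A = word_val G f (SOME w. w \<in> A)" for A
  have h: "h (pres_class R w) = word_val G f w" for w
  proof -
    have "(SOME v. v \<in> pres_class R w) \<in> pres_class R w"
      by (rule someI[of _ w]) (simp add: pres_class_def pres_eq.refl)
    then show ?thesis
      unfolding h_def by (metis mem_Collect_eq pres_class_def resp)
  qed
  have "h \<in> hom (presented_group R) G"
    by (auto simp: hom_def pres_carrier h closed pres_mult app)
  moreover have "h (pres_gen R g) = f g" for g
    using f by (simp add: pres_gen_def h)
  ultimately show ?thesis by blast
qed


section \<open>Dihedral and dicyclic groups\<close>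

datatype dihedral_gen = R_gen | S_gen

definition dihedral_rels :: "nat \<Rightarrow> (dihedral_gen word \<times> dihedral_gen word) set" where
  "dihedral_rels n =
    {(replicate n (R_gen, True), []),
     ([(S_gen, True), (S_gen, True)], []),
     ([(S_gen, True), (R_gen, True), (S_gen, True)], [(R_gen, False)])}"

definition dihedral_group :: "nat \<Rightarrow> dihedral_gen word set monoid" where
  "dihedral_group n = presented_group (dihedral_rels n)"

datatype dicyclic_gen = X_gen | Y_gen

definition dicyclic_rels :: "nat \<Rightarrow> (dicyclic_gen word \<times> dicyclic_gen word) set" where
  "dicyclic_rels n =
    {(replicate (2 * n) (X_gen, True), []),
     (replicate n (X_gen, True), [(Y_gen, True), (Y_gen, True)]),
     ([(Y_gen, True), (X_gen, True)], [(X_gen, False), (Y_gen, True)])}"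

definition dicyclic_group :: "nat \<Rightarrow> dicyclic_gen word set monoid" where
  "dicyclic_group n = presented_group (dicyclic_rels n)"

definition dicyclic_x :: "nat \<Rightarrow> dicyclic_gen word set" where
  "dicyclic_x n = pres_gen (dicyclic_rels n) X_gen"

definition dicyclic_y :: "nat \<Rightarrow> dicyclic_gen word set" where
  "dicyclic_y n = pres_gen (dicyclic_rels n) Y_gen"


section \<open>Generating graphs and quotient graphs\<close>

text \<open>
  As usual in the Graph Theory entry, a simple undirected graph is a loop-free symmetric
  digraph without parallel arcs.
\<close>

definition generating_graph :: "('a, 'm) monoid_scheme \<Rightarrow> 'a pair_pre_digraph" where
  "generating_graph G =
    \<lparr>pverts = carrier G,
     parcs = {(g, h). g \<in> carrier G \<and> h \<in> carrier G \<and> g \<noteq> h \<and> generate G {g, h} = carrier G}\<rparr>"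

definition quotient_graph :: "'a pair_pre_digraph \<Rightarrow> 'a set set \<Rightarrow> 'a set pair_pre_digraph" where
  "quotient_graph X P =
    \<lparr>pverts = P,
     parcs = {(U, V). U \<in> P \<and> V \<in> P \<and> U \<noteq> V \<and> (\<exists>a\<in>U. \<exists>b\<in>V. (a, b) \<in> parcs X)}\<rparr>"

lemma generating_graph_bidirected: "pair_bidirected_digraph (generating_graph G)"
proof unfold_locales
  show "symmetric (with_proj (generating_graph G))"
    unfolding symmetric_def with_proj_simps
  proof (rule symI)
    fix a b assume "(a, b) \<in> parcs (generating_graph G)"
    then show "(b, a) \<in> parcs (generating_graph G)"
      by (auto simp: generating_graph_def insert_commute[of b a "{}"])
  qed
qed (simp_all add: generating_graph_def case_prod_beta)

lemma quotient_graph_bidirected: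
  assumes "pair_bidirected_digraph X"
  shows "pair_bidirected_digraph (quotient_graph X P)"
proof -
  interpret pair_bidirected_digraph X by fact
  have sym: "(b, a) \<in> parcs X" if "(a, b) \<in> parcs X" for a b
    using pair_sym_arcs that unfolding symmetric_def with_proj_simps by (rule symD)
  show ?thesis
  proof unfold_locales
    show "symmetric (with_proj (quotient_graph X P))"
      unfolding symmetric_def with_proj_simps
      by (rule symI) (simp add: quotient_graph_def, blast intro: sym)
  qed (simp_all add: quotient_graph_def case_prod_beta)
qed

definition Theta :: "nat \<Rightarrow> dicyclic_gen word set set set" where
  "Theta n =
    (let Q = dicyclic_group n; x = dicyclic_x n; y = dicyclic_y n in
      {{x [^]\<^bsub>Q\<^esub> i, x [^]\<^bsub>Q\<^esub> (n + i)} | i. i < n} \<union>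
      {{y, y [^]\<^bsub>Q\<^esub> (3::nat)}} \<union>
      {{x [^]\<^bsub>Q\<^esub> i \<otimes>\<^bsub>Q\<^esub> y, x [^]\<^bsub>Q\<^esub> (n + i) \<otimes>\<^bsub>Q\<^esub> y} | i. 1 \<le> i \<and> i < n})"

end

theory Submission
  imports Defs
begin

text \<open>
  Put \<open>z = x\<^sup>n = y\<^sup>2\<close>. The assignment \<open>x \<mapsto> r\<close>, \<open>y \<mapsto> s\<close> defines an epimorphism \<open>h\<close> from the
  dicyclic to the dihedral group. Since \<open>r \<mapsto> Zx\<close>, \<open>s \<mapsto> Zy\<close> defines a homomorphism from the dihedral
  group to the quotient by \<open>Z = {1, z}\<close>, the kernel of \<open>h\<close> is exactly \<open>Z\<close>, and the cells of \<open>Theta\<close>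
  are the cosets of \<open>Z\<close>. A subgroup that \<open>h\<close> maps onto the dihedral group contains \<open>y\<close> or \<open>zy\<close>,
  both of which square to \<open>z\<close>; so it contains the kernel and is the whole group. Hence two elements
  generate the dicyclic group iff their images generate the dihedral group.
\<close>

section \<open>Quotients of generating graphs by kernels\<close>

text \<open>In a pair digraph an arc is its pair of endpoints, so \<open>f\<close> already
  determines the arc map \<open>map_prod f f\<close>. Every arc of \<open>Y\<close> must join
  vertices of \<open>Y\<close> in order to be the image of an arc of \<open>X\<close>.\<close>

lemma digraph_isoI:
  assumes "pair_wf_digraph X" and f: "bij_betw f (pverts X) (pverts Y)"
    and Y: "parcs Y \<subseteq> pverts Y \<times> pverts Y"
    and arcs: "\<And>u v. u \<in> pverts X \<Longrightarrow> v \<in> pverts X \<Longrightarrow> (u, v) \<in> parcs X \<longleftrightarrow> (f u, f v) \<in> parcs Y"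
  shows "digraph_iso (with_proj X) (with_proj Y)"
proof -
  interpret pair_wf_digraph X by fact
  let ?f = "\<lparr>iso_verts = f, iso_arcs = map_prod f f, iso_head = snd, iso_tail = fst\<rparr>"
  have X: "parcs X \<subseteq> pverts X \<times> pverts X"
    using in_arcsD1 in_arcsD2 by auto
  have inj: "inj_on f (pverts X)" and onto: "f ` pverts X = pverts Y"
    using f by (auto simp: bij_betw_def)
  have "inj_on (map_prod f f) (parcs X)"
    using map_prod_inj_on[OF inj inj] X by (rule inj_on_subset)
  then have "digraph_isomorphism ?f"
    using inj wf_digraph_axioms by (simp add: digraph_isomorphism_def)
  moreover have "map_prod f f ` parcs X = parcs Y"
  proof
    show "map_prod f f ` parcs X \<subseteq> parcs Y"
      using X arcs by auto
    show "parcs Y \<subseteq> map_prod f f ` parcs X"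
    proof
      fix e assume e: "e \<in> parcs Y"
      then obtain u v where "e = (f u, f v)" "u \<in> pverts X" "v \<in> pverts X"
        using Y onto by (cases e) blast
      then show "e \<in> map_prod f f ` parcs X"
        using e arcs by force
    qed
  qed
  then have "with_proj Y = app_iso ?f (with_proj X)"
    using onto by (simp add: app_iso_def with_proj_def)
  ultimately show ?thesis
    unfolding digraph_iso_def by blast
qed

lemma (in group) partition_on_rcosets:
  assumes "subgroup H G"
  shows "partition_on (carrier G) (rcosets H)"
  using rcosets_part_G[OF assms] rcos_disjoint[OF assms] subgroup.rcosets_non_empty[OF assms]
  by (intro partition_onI) (auto simp: pairwise_def)

text \<open>Assumption \<open>frattini\<close> says that no proper subgroup supplements the kernel.
  Generation by a pair then depends only on the images of the pair, so adjacency of two cosets can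
  be tested on any representatives.\<close>

lemma (in group_hom) quotient_generating_graph_iso:
  assumes onto: "h ` carrier G = carrier H"
    and frattini: "\<And>K. subgroup K G \<Longrightarrow> h ` K = carrier H \<Longrightarrow> K = carrier G"
  shows "digraph_iso (with_proj (quotient_graph (generating_graph G) (rcosets (kernel G H h))))
    (with_proj (generating_graph H))"
proof (rule digraph_isoI)
  let ?f = "\<lambda>X. the_elem (h ` X)"
  let ?Q = "quotient_graph (generating_graph G) (rcosets (kernel G H h))"
  have "pair_bidirected_digraph ?Q"
    by (intro quotient_graph_bidirected generating_graph_bidirected)
  then interpret Q: pair_bidirected_digraph ?Q .
  show "pair_wf_digraph ?Q" ..
  \<comment> \<open>The vertex bijection is the map of the first isomorphism theorem.\<close>
  have "?f \<in> iso (G Mod kernel G H h) H"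
    using onto by (rule FactGroup_iso_set)
  then have bij: "bij_betw ?f (rcosets (kernel G H h)) (carrier H)"
    by (simp add: iso_def FactGroup_def)
  then show "bij_betw ?f (pverts ?Q) (pverts (generating_graph H))"
    by (simp add: quotient_graph_def generating_graph_def)
  show "parcs (generating_graph H) \<subseteq> pverts (generating_graph H) \<times> pverts (generating_graph H)"
    by (auto simp: generating_graph_def)
  fix U V assume "U \<in> pverts ?Q" "V \<in> pverts ?Q"
  then have U: "U \<in> rcosets (kernel G H h)" and V: "V \<in> rcosets (kernel G H h)"
    by (simp_all add: quotient_graph_def)
  \<comment> \<open>\<open>h\<close> is constant on each coset of its kernel, so
    \<open>the_elem\<close> picks out that constant value.\<close>
  have image: "h ` W = {?f W}" "W \<subseteq> carrier G" if W: "W \<in> rcosets (kernel G H h)" for W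
  proof -
    obtain g where g: "g \<in> carrier G" "W = kernel G H h #> g"
      using W by (auto simp: RCOSETS_def)
    have "h a = h g" if "a \<in> W" for a
      using that g by (auto simp: r_coset_def kernel_def)
    moreover have "g \<in> W"
      using G.rcos_self[OF g(1) subgroup_kernel] g(2) by simp
    ultimately have "h ` W = {h g}"
      by blast
    then show "h ` W = {?f W}" by simp
    show "W \<subseteq> carrier G"
      using W G.rcosets_part_G[OF subgroup_kernel] by blast
  qed
  have neq: "U \<noteq> V \<longleftrightarrow> ?f U \<noteq> ?f V"
    using bij U V by (auto simp: bij_betw_def dest: inj_onD)
  have gen: "generate G {a, b} = carrier G \<longleftrightarrow> generate H {h a, h b} = carrier H"
    if "a \<in> carrier G" "b \<in> carrier G" for a b
  proof -
    have "generate H {h a, h b} = h ` generate G {a, b}"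
      using generate_img[of "{a, b}"] that by simp
    moreover have "subgroup (generate G {a, b}) G"
      using that by (intro G.generate_is_subgroup) simp
    \<comment> \<open>Left to right uses \<open>onto\<close>; right to left applies
      \<open>frattini\<close> to the subgroup generated by \<open>a\<close> and
      \<open>b\<close>.\<close>
    ultimately show ?thesis
      using onto frattini by metis
  qed
  obtain a b where ab: "a \<in> U" "b \<in> V"
    using subgroup.rcosets_non_empty[OF subgroup_kernel] U V by blast
  have val: "h a = ?f U" if "a \<in> U" for a
    using image(1)[OF U] that by blast
  have val': "h b = ?f V" if "b \<in> V" for b
    using image(1)[OF V] that by blast
  have sub: "U \<subseteq> carrier G" "V \<subseteq> carrier G"
    using image(2) U V by auto
  have closed: "?f U \<in> carrier H" "?f V \<in> carrier H"
    using bij U V by (auto simp: bij_betw_def)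
  show "(U, V) \<in> parcs ?Q \<longleftrightarrow> (?f U, ?f V) \<in> parcs (generating_graph H)"
  proof
    assume "(U, V) \<in> parcs ?Q"
    then obtain a b where "a \<in> U" "b \<in> V" "U \<noteq> V" "generate G {a, b} = carrier G"
      by (auto simp: quotient_graph_def generating_graph_def)
    then show "(?f U, ?f V) \<in> parcs (generating_graph H)"
      using gen[of a b] val[of a] val'[of b] sub neq closed by (auto simp: generating_graph_def)
  next
    assume "(?f U, ?f V) \<in> parcs (generating_graph H)"
    then have "?f U \<noteq> ?f V" "generate H {h a, h b} = carrier H"
      using ab val val' by (auto simp: generating_graph_def)
    \<comment> \<open>The chosen representatives are distinct because their images are.\<close>
    then have "(a, b) \<in> parcs (generating_graph G)"
      using gen[of a b] ab sub val[of a] val'[of b] by (auto simp: generating_graph_def)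
    then show "(U, V) \<in> parcs ?Q"
      using ab U V neq \<open>?f U \<noteq> ?f V\<close> by (auto simp: quotient_graph_def)
  qed
qed

lemma homs_agree_on_generate:
  assumes "group_hom G H f" "group_hom G H g" and S: "S \<subseteq> carrier G"
    and eq: "\<And>s. s \<in> S \<Longrightarrow> f s = g s" and a: "a \<in> generate G S"
  shows "f a = g a"
proof -
  interpret f: group_hom G H f by fact
  interpret g: group_hom G H g by fact
  show ?thesis
    using a
  proof induction
    case (eng a b)
    then show ?case
      using f.G.generate_in_carrier[OF S] by simp
  qed (use S eq in \<open>auto simp: subset_iff\<close>)
qed


section \<open>Groups generated by a dicyclic pair\<close>

text \<open>Records the relations and generation, but not the exact order of \<open>x\<close>.
  Descriptions of cells and cosets below are therefore equalities of sets and claim nothing about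
  their sizes.\<close>

locale dicyclic_pair = group G for G (structure) +
  fixes n :: nat and x y
  assumes n: "n > 0"
    and x [simp]: "x \<in> carrier G" and y [simp]: "y \<in> carrier G"
    and x_order: "x [^] (2 * n) = \<one>"
    and x_pow_n: "x [^] n = y \<otimes> y"
    and yx: "y \<otimes> x = inv x \<otimes> y"
    and gen: "generate G {x, y} = carrier G"
begin

definition Z where "Z = {\<one>, x [^] n}"

text \<open>Allows all later exponents to be natural numbers; \<open>n > 0\<close> keeps the
  subtraction from truncating.\<close>

lemma inv_x: "inv x = x [^] (2 * n - 1)"
proof (rule inv_equality)
  have "x [^] (2 * n - 1) \<otimes> x = x [^] Suc (2 * n - 1)"
    by simp
  then show "x [^] (2 * n - 1) \<otimes> x = \<one>"
    using n x_order by simp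
qed simp_all

lemma z_square: "x [^] n \<otimes> x [^] n = \<one>"
  using x_order by (simp add: nat_pow_mult mult_2)

lemma inv_y: "inv y = x [^] n \<otimes> y"
  using z_square by (intro inv_equality) (simp_all add: m_assoc flip: x_pow_n)

text \<open>Moving \<open>y\<close> past \<open>x\<close> inverts \<open>x\<close>, and the factor
  \<open>2 * n - 1\<close> plays the part of \<open>-1\<close> in the exponent.\<close>

lemma y_x_pow: "y \<otimes> x [^] (j::nat) = x [^] ((2 * n - 1) * j) \<otimes> y"
proof (induction j)
  case (Suc j)
  have "y \<otimes> x [^] Suc j = x [^] ((2 * n - 1) * j) \<otimes> (y \<otimes> x)"
    using Suc by (simp flip: m_assoc)
  also have "\<dots> = x [^] ((2 * n - 1) * Suc j) \<otimes> y"
    by (simp add: yx inv_x nat_pow_mult add.commute flip: m_assoc)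
  finally show ?case .
qed simp

text \<open>The two families contain the generators and their inverses and are closed under
  products, hence exhaust the generated group. Exponents are neither reduced nor claimed to be
  unique.\<close>

lemma normal_form:
  assumes "g \<in> carrier G"
  obtains i :: nat where "g = x [^] i" | i :: nat where "g = x [^] i \<otimes> y"
proof -
  let ?N = "range (\<lambda>i::nat. x [^] i) \<union> range (\<lambda>i::nat. x [^] i \<otimes> y)"
  have pow: "x [^] i \<in> ?N" "x [^] i \<otimes> y \<in> ?N" for i :: nat
    by auto
  have "g \<in> generate G {x, y}"
    using assms gen by simp
  then have "g \<in> ?N"
  proof induction
    case one
    show ?case using pow(1)[of 0] by simp
  next
    case (incl g)
    then show ?case using pow(1)[of 1] pow(2)[of 0] by auto
  next
    case (inv g)
    then show ?case using pow by (auto simp only: inv_x inv_y)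
  next
    case (eng a b)
    consider i j :: nat where "a = x [^] i" "b = x [^] j"
      | i j :: nat where "a = x [^] i" "b = x [^] j \<otimes> y"
      | i j :: nat where "a = x [^] i \<otimes> y" "b = x [^] j"
      | i j :: nat where "a = x [^] i \<otimes> y" "b = x [^] j \<otimes> y"
      using eng.IH by blast
    then show ?case
    proof cases
      case 1
      then show ?thesis using pow by (simp add: nat_pow_mult)
    next
      case 2
      then show ?thesis using pow by (simp add: nat_pow_mult flip: m_assoc)
    next
      case (3 i j)
      then have "a \<otimes> b = x [^] (i + (2 * n - 1) * j) \<otimes> y"
        by (simp add: m_assoc y_x_pow) (simp add: nat_pow_mult flip: m_assoc)
      then show ?thesis using pow by simp
    next
      case (4 i j)
      \<comment> \<open>After \<open>y\<close> is moved past the power of \<open>x\<close>, the two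
        copies of \<open>y\<close> meet and merge into \<open>x [^] n\<close>.\<close>
      then have "a \<otimes> b = x [^] i \<otimes> (y \<otimes> x [^] j) \<otimes> y"
        by (simp add: m_assoc)
      also have "\<dots> = x [^] i \<otimes> x [^] ((2 * n - 1) * j) \<otimes> x [^] n"
        by (simp add: y_x_pow x_pow_n m_assoc)
      also have "\<dots> = x [^] (i + (2 * n - 1) * j + n)"
        by (simp add: nat_pow_mult)
      finally show ?thesis using pow by simp
    qed
  qed
  then show thesis using that by blast
qed

section \<open>The central subgroup \<open>Z\<close> and its cosets\<close>

text \<open>The element commutes with \<open>x\<close> as a power of \<open>x\<close>, and with
  \<open>y\<close> because it equals \<open>y \<otimes> y\<close>.\<close>

lemma z_central:
  assumes "g \<in> carrier G"
  shows "g \<otimes> x [^] n = x [^] n \<otimes> g"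
proof (cases rule: normal_form[OF assms])
  case 1
  then show ?thesis by (simp add: nat_pow_mult add.commute)
next
  case (2 i)
  have "x [^] i \<otimes> y \<otimes> x [^] n = x [^] i \<otimes> x [^] n \<otimes> y"
    by (simp add: x_pow_n m_assoc)
  also have "\<dots> = x [^] n \<otimes> (x [^] i \<otimes> y)"
    by (simp add: nat_pow_mult add.commute flip: m_assoc)
  finally show ?thesis using 2 by simp
qed

lemma subgroup_Z: "subgroup Z G"
proof (rule subgroupI)
  have "inv (x [^] n) = x [^] n"
    using z_square by (intro inv_equality) simp_all
  then show "\<And>a. a \<in> Z \<Longrightarrow> inv a \<in> Z"
    by (auto simp: Z_def)
qed (auto simp: Z_def z_square)

lemma normal_Z: "Z \<lhd> G"
proof (rule normal_invI[OF subgroup_Z])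
  fix g a assume "g \<in> carrier G" "a \<in> Z"
  then show "g \<otimes> a \<otimes> inv g \<in> Z"
    by (auto simp: Z_def z_central m_assoc)
qed

lemma coset_Z: "g \<in> carrier G \<Longrightarrow> Z #> g = {g, x [^] n \<otimes> g}"
  by (auto simp: Z_def r_coset_def)

text \<open>Division with remainder splits off a power of \<open>x [^] n\<close>, which
  \<open>Z\<close> absorbs.\<close>

lemma coset_x_pow_mod: "Z #> x [^] i = Z #> x [^] (i mod n)"
proof -
  have "x [^] i = (x [^] n) [^] (i div n) \<otimes> x [^] (i mod n)"
    by (simp add: nat_pow_pow nat_pow_mult)
  moreover have "(x [^] n) [^] k \<in> Z" for k :: nat
    using z_square by (induction k) (auto simp: Z_def)
  ultimately have "x [^] i \<in> Z #> x [^] (i mod n)"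
    by (auto simp: r_coset_def)
  from repr_independence[OF this _ subgroup_Z] show ?thesis by simp
qed

text \<open>Multiplication by \<open>x [^] n\<close> pairs exponent \<open>i\<close> with
  \<open>n + i\<close>. Normal forms reach every coset, and reduction modulo \<open>n\<close> brings
  the exponent into range.\<close>

lemma rcosets_Z:
  "rcosets Z = {{x [^] i, x [^] (n + i)} | i. i < n} \<union>
    {{x [^] i \<otimes> y, x [^] (n + i) \<otimes> y} | i. i < n}" (is "_ = ?A \<union> ?B")
proof
  have A: "{x [^] i, x [^] (n + i)} = Z #> x [^] i" for i
    by (simp add: coset_Z nat_pow_mult)
  have B: "{x [^] i \<otimes> y, x [^] (n + i) \<otimes> y} = Z #> (x [^] i \<otimes> y)" for i
    by (simp add: coset_Z) (simp add: nat_pow_mult flip: m_assoc)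
  have Z: "Z \<subseteq> carrier G"
    using subgroup_Z by (rule subgroup.subset)
  have "Z #> x [^] i \<in> rcosets Z" "Z #> (x [^] i \<otimes> y) \<in> rcosets Z" for i :: nat
    by (intro rcosetsI Z; simp)+
  then show "?A \<union> ?B \<subseteq> rcosets Z"
    by (auto simp only: A B mem_Collect_eq Un_iff)
  have "Z #> g \<in> ?A \<union> ?B" if "g \<in> carrier G" for g
    using that
  proof (cases rule: normal_form)
    case (1 i)
    then have "Z #> g = {x [^] (i mod n), x [^] (n + i mod n)}"
      by (simp only: A coset_x_pow_mod[of i])
    moreover have "i mod n < n" using n by simp
    ultimately show ?thesis by blast
  next
    case (2 i)
    then have "Z #> g = Z #> x [^] i #> y"
      using Z by (simp add: coset_mult_assoc)
    also have "\<dots> = Z #> (x [^] (i mod n) \<otimes> y)"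
      using Z by (subst coset_x_pow_mod[of i]) (simp add: coset_mult_assoc)
    finally have "Z #> g = {x [^] (i mod n) \<otimes> y, x [^] (n + i mod n) \<otimes> y}"
      by (simp add: B)
    moreover have "i mod n < n" using n by simp
    ultimately show ?thesis by blast
  qed
  then show "rcosets Z \<subseteq> ?A \<union> ?B"
    by (auto simp: RCOSETS_def)
qed

lemma rcosets_Z_eq_cells:
  "rcosets Z = {{x [^] i, x [^] (n + i)} | i. i < n} \<union> {{y, y [^] (3::nat)}} \<union>
    {{x [^] i \<otimes> y, x [^] (n + i) \<otimes> y} | i. 1 \<le> i \<and> i < n}"
proof -
  have cube: "y [^] (3::nat) = x [^] n \<otimes> y"
    by (simp add: x_pow_n numeral_3_eq_3)
  \<comment> \<open>\<open>Theta\<close> lists the cell of index 0 in the \<open>y\<close> row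
    separately, as \<open>y\<close> with its cube.\<close>
  have split: "{f i | i. i < n} = insert (f 0) {f i | i. 1 \<le> i \<and> i < n}" for f :: "nat \<Rightarrow> 'a set"
    using n by (auto simp: Suc_le_eq)
  show ?thesis
    unfolding rcosets_Z
    by (subst split[of "\<lambda>i. {x [^] i \<otimes> y, x [^] (n + i) \<otimes> y}"]) (auto simp: cube)
qed

end


section \<open>From the dicyclic to the dihedral group\<close>

lemma (in group) word_val_replicate:
  "f g \<in> carrier G \<Longrightarrow> word_val G f (replicate k (g, True)) = f g [^] k"
  by (induction k) (simp_all, metis nat_pow_Suc nat_pow_Suc2)

lemma pres_gen_closed [simp]: "pres_gen R g \<in> carrier (presented_group R)"
  by (simp add: pres_gen_def pres_carrier)

lemma dicyclic_pair_dicyclic_group: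
  assumes "n > 0"
  shows "dicyclic_pair (dicyclic_group n) n (dicyclic_x n) (dicyclic_y n)"
proof -
  interpret group "presented_group (dicyclic_rels n)" by (rule group_presented_group)
  have "(replicate (2 * n) (X_gen, True), []) \<in> dicyclic_rels n"
    "(replicate n (X_gen, True), [(Y_gen, True), (Y_gen, True)]) \<in> dicyclic_rels n"
    "([(Y_gen, True), (X_gen, True)], [(X_gen, False), (Y_gen, True)]) \<in> dicyclic_rels n"
    by (simp_all add: dicyclic_rels_def)
  note rels = this[THEN presented_group_relation]
  show ?thesis
    unfolding dicyclic_group_def dicyclic_x_def dicyclic_y_def
  proof unfold_locales
    have "range (pres_gen (dicyclic_rels n)) =
        {pres_gen (dicyclic_rels n) X_gen, pres_gen (dicyclic_rels n) Y_gen}"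
      by (auto simp: image_iff) (metis dicyclic_gen.exhaust)+
    then show "generate (presented_group (dicyclic_rels n))
        {pres_gen (dicyclic_rels n) X_gen, pres_gen (dicyclic_rels n) Y_gen} =
        carrier (presented_group (dicyclic_rels n))"
      using presented_group_generated[of "dicyclic_rels n"] by simp
  qed (use assms rels in \<open>simp_all add: word_val_replicate\<close>)
qed

lemma dicyclic_to_dihedral:
  assumes "n > 0"
  shows "\<exists>h. group_hom (dicyclic_group n) (dihedral_group n) h \<and>
    h ` carrier (dicyclic_group n) = carrier (dihedral_group n) \<and>
    kernel (dicyclic_group n) (dihedral_group n) h =
      {\<one>\<^bsub>dicyclic_group n\<^esub>, dicyclic_x n [^]\<^bsub>dicyclic_group n\<^esub> n}"
proof -
  define r s where "r = pres_gen (dihedral_rels n) R_gen" and "s = pres_gen (dihedral_rels n) S_gen"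
  define Q D x y where "Q = dicyclic_group n" and "D = dihedral_group n"
    and "x = dicyclic_x n" and "y = dicyclic_y n"
  interpret Q: dicyclic_pair Q n x y
    unfolding Q_def x_def y_def using assms by (rule dicyclic_pair_dicyclic_group)
  interpret D: group D
    unfolding D_def dihedral_group_def by (rule group_presented_group)
  interpret Z: normal Q.Z Q by (rule Q.normal_Z)
  interpret M: group "Q Mod Q.Z" by (rule Z.factorgroup_is_group)
  interpret p: group_hom Q "Q Mod Q.Z" "\<lambda>a. Q.Z #>\<^bsub>Q\<^esub> a"
    by unfold_locales (rule Z.r_coset_hom_Mod)
  have rs [simp]: "r \<in> carrier D" "s \<in> carrier D"
    by (simp_all add: r_def s_def D_def dihedral_group_def)
  have "(replicate n (R_gen, True), []) \<in> dihedral_rels n"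
    "([(S_gen, True), (S_gen, True)], []) \<in> dihedral_rels n"
    "([(S_gen, True), (R_gen, True), (S_gen, True)], [(R_gen, False)]) \<in> dihedral_rels n"
    by (simp_all add: dihedral_rels_def)
  note rels = this[THEN presented_group_relation, folded dihedral_group_def, folded D_def]
  have r_pow: "r [^]\<^bsub>D\<^esub> n = \<one>\<^bsub>D\<^esub>"
    using rels(1) rs by (simp add: D.word_val_replicate r_def)
  have ss: "s \<otimes>\<^bsub>D\<^esub> s = \<one>\<^bsub>D\<^esub>"
    using rels(2) rs by (simp add: s_def)
  have srs: "s \<otimes>\<^bsub>D\<^esub> (r \<otimes>\<^bsub>D\<^esub> s) = inv\<^bsub>D\<^esub> r"
    using rels(3) rs by (simp add: r_def s_def)
  \<comment> \<open>With \<open>s\<close> an involution, the dihedral relation takes the shape of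
    the dicyclic one.\<close>
  have sr: "s \<otimes>\<^bsub>D\<^esub> r = inv\<^bsub>D\<^esub> r \<otimes>\<^bsub>D\<^esub> s"
    by (simp add: D.m_assoc ss flip: srs)
  have gen_D: "generate D {r, s} = carrier D"
  proof -
    have "range (pres_gen (dihedral_rels n)) = {r, s}"
      by (auto simp: image_iff r_def s_def) (metis dihedral_gen.exhaust)+
    then show ?thesis
      using presented_group_generated[of "dihedral_rels n"]
      by (simp add: D_def dihedral_group_def)
  qed

  \<comment> \<open>\<open>r\<close> and \<open>s\<close> satisfy the dicyclic relations:
    \<open>r [^] n\<close> and the square of \<open>s\<close> are both trivial, hence equal.\<close>
  have "\<exists>h \<in> hom (presented_group (dicyclic_rels n)) D.
      \<forall>g. h (pres_gen (dicyclic_rels n) g) = case_dicyclic_gen r s g"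
  proof (rule presented_group_universal[OF D.is_group])
    show "case_dicyclic_gen r s g \<in> carrier D" for g
      by (cases g) simp_all
    have "r [^]\<^bsub>D\<^esub> (2 * n) = \<one>\<^bsub>D\<^esub>"
      using r_pow by (simp add: mult_2 flip: D.nat_pow_mult)
    then show "word_val D (case_dicyclic_gen r s) u = word_val D (case_dicyclic_gen r s) v"
      if "(u, v) \<in> dicyclic_rels n" for u v
      using that r_pow ss sr by (auto simp: dicyclic_rels_def D.word_val_replicate)
  qed
  then obtain h where h: "h \<in> hom Q D"
    and "\<forall>g. h (pres_gen (dicyclic_rels n) g) = case_dicyclic_gen r s g"
    unfolding Q_def dicyclic_group_def by blast
  then have hx: "h x = r" and hy: "h y = s"
    by (simp_all add: x_def y_def dicyclic_x_def dicyclic_y_def)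
  interpret h: group_hom Q D h
    using h by unfold_locales
  have "h ` generate Q {x, y} = generate D {r, s}"
    using h.generate_img[of "{x, y}"] by (simp add: hx hy)
  then have onto: "h ` carrier Q = carrier D"
    by (simp add: Q.gen gen_D)

  \<comment> \<open>A map \<open>k\<close> back to the quotient by \<open>Z\<close> is built in
    order to bound the kernel of \<open>h\<close> from above.\<close>
  let ?k = "case_dihedral_gen (Q.Z #>\<^bsub>Q\<^esub> x) (Q.Z #>\<^bsub>Q\<^esub> y)"
  have z: "Q.Z #>\<^bsub>Q\<^esub> (x [^]\<^bsub>Q\<^esub> n) = \<one>\<^bsub>Q Mod Q.Z\<^esub>"
    using Q.coset_join2[OF _ Q.subgroup_Z] by (simp add: Q.Z_def)
  have "\<exists>k \<in> hom (presented_group (dihedral_rels n)) (Q Mod Q.Z).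
      \<forall>g. k (pres_gen (dihedral_rels n) g) = ?k g"
  proof (rule presented_group_universal[OF M.is_group])
    show k: "?k g \<in> carrier (Q Mod Q.Z)" for g
      using p.hom_closed by (cases g) simp_all
    have yy: "Q.Z #>\<^bsub>Q\<^esub> (y \<otimes>\<^bsub>Q\<^esub> y) = \<one>\<^bsub>Q Mod Q.Z\<^esub>"
      using z by (simp only: Q.x_pow_n)
    \<comment> \<open>In the quotient the trailing square of \<open>y\<close> becomes trivial, which
      leaves the dihedral relation.\<close>
    have "y \<otimes>\<^bsub>Q\<^esub> (x \<otimes>\<^bsub>Q\<^esub> y) = inv\<^bsub>Q\<^esub> x \<otimes>\<^bsub>Q\<^esub> (y \<otimes>\<^bsub>Q\<^esub> y)"
      by (simp add: Q.yx flip: Q.m_assoc)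
    then have yxy: "Q.Z #>\<^bsub>Q\<^esub> (y \<otimes>\<^bsub>Q\<^esub> (x \<otimes>\<^bsub>Q\<^esub> y)) = inv\<^bsub>Q Mod Q.Z\<^esub> (Q.Z #>\<^bsub>Q\<^esub> x)"
      using yy M.r_one[OF M.inv_closed[OF p.hom_closed[OF Q.x]]]
      by (simp only: p.hom_mult p.hom_inv Q.x Q.y Q.inv_closed Q.m_closed)
    show "word_val (Q Mod Q.Z) ?k u = word_val (Q Mod Q.Z) ?k v"
      if "(u, v) \<in> dihedral_rels n" for u v
    proof -
      have X: "Q.Z #>\<^bsub>Q\<^esub> x \<in> carrier (Q Mod Q.Z)" and Y: "Q.Z #>\<^bsub>Q\<^esub> y \<in> carrier (Q Mod Q.Z)"
        by (rule p.hom_closed, rule Q.x Q.y)+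
      have "word_val (Q Mod Q.Z) ?k (replicate n (R_gen, True)) = \<one>\<^bsub>Q Mod Q.Z\<^esub>"
        using z unfolding p.hom_nat_pow[OF Q.x] by (subst M.word_val_replicate) (simp_all only: dihedral_gen.case X)
      moreover have "word_val (Q Mod Q.Z) ?k [(S_gen, True), (S_gen, True)] = \<one>\<^bsub>Q Mod Q.Z\<^esub>"
        using yy by (simp only: word_val.simps dihedral_gen.case if_True p.hom_mult Q.y M.r_one Y)
      moreover have "word_val (Q Mod Q.Z) ?k [(S_gen, True), (R_gen, True), (S_gen, True)] =
          word_val (Q Mod Q.Z) ?k [(R_gen, False)]"
        using yxy by (simp only: word_val.simps dihedral_gen.case if_True if_False simp_thms
            p.hom_mult Q.x Q.y Q.m_closed M.r_one X Y M.inv_closed)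
      ultimately show ?thesis
        using that by (auto simp only: dihedral_rels_def insert_iff empty_iff prod.inject word_val.simps(1))
    qed
  qed
  then obtain k where k: "k \<in> hom D (Q Mod Q.Z)"
    and "\<forall>g. k (pres_gen (dihedral_rels n) g) = ?k g"
    unfolding D_def dihedral_group_def by blast
  then have kr: "k r = Q.Z #>\<^bsub>Q\<^esub> x" and ks: "k s = Q.Z #>\<^bsub>Q\<^esub> y"
    by (simp_all add: r_def s_def)
  interpret k: group_hom D "Q Mod Q.Z" k
    using k by unfold_locales
  have "group_hom Q (Q Mod Q.Z) (k \<circ> h)"
    using hom_compose[OF h k] by unfold_locales
  \<comment> \<open>The composite and the canonical projection agree on both generators.\<close>
  then have kh: "(k \<circ> h) g = Q.Z #>\<^bsub>Q\<^esub> g" if "g \<in> carrier Q" for g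
    by (rule homs_agree_on_generate[OF _ p.group_hom_axioms, where S = "{x, y}"])
      (use that in \<open>auto simp: hx hy kr ks Q.gen\<close>)

  have "kernel Q D h = {\<one>\<^bsub>Q\<^esub>, x [^]\<^bsub>Q\<^esub> n}"
  proof
    show "{\<one>\<^bsub>Q\<^esub>, x [^]\<^bsub>Q\<^esub> n} \<subseteq> kernel Q D h"
      by (simp add: kernel_def h.hom_nat_pow hx r_pow)
    show "kernel Q D h \<subseteq> {\<one>\<^bsub>Q\<^esub>, x [^]\<^bsub>Q\<^esub> n}"
    proof
      fix g assume "g \<in> kernel Q D h"
      \<comment> \<open>If \<open>h\<close> kills \<open>g\<close>, then so does
        \<open>k \<circ> h\<close>, so the coset of \<open>g\<close> is trivial.\<close>
      then have "g \<in> carrier Q" "Q.Z #>\<^bsub>Q\<^esub> g = Q.Z"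
        using kh[of g] k.hom_one by (auto simp: kernel_def)
      then have "g \<in> Q.Z"
        using Q.coset_join1 Q.subgroup_Z by blast
      then show "g \<in> {\<one>\<^bsub>Q\<^esub>, x [^]\<^bsub>Q\<^esub> n}"
        by (simp add: Q.Z_def)
    qed
  qed
  then show ?thesis
    using h.group_hom_axioms onto unfolding Q_def D_def x_def by blast
qed

section \<open>The supplement property and the conclusion\<close>

text \<open>\<open>K\<close> meets every coset of \<open>Z\<close>, so it remains to find
  \<open>x [^] n\<close> in \<open>K\<close>. It arises there as the square of an element in the
  coset of \<open>y\<close>.\<close>

lemma (in dicyclic_pair) subgroup_onto_imp_whole:
  assumes "group_hom G H h" and ker: "kernel G H h = Z"
    and K: "subgroup K G" and onto: "h ` K = carrier H"
  shows "K = carrier G"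
proof
  interpret h: group_hom G H h by fact
  show "K \<subseteq> carrier G"
    using K by (rule subgroup.subset)
  have lift: "\<exists>b\<in>K. \<exists>a\<in>Z. g = a \<otimes> b" if g: "g \<in> carrier G" for g
  proof -
    obtain b where b: "b \<in> K" "h b = h g"
      using onto g h.hom_closed by (metis imageE)
    then have "b \<in> carrier G"
      using K subgroup.subset by blast
    then have "g \<otimes> inv b \<in> Z" "g = g \<otimes> inv b \<otimes> b"
      using b g by (simp_all add: m_assoc flip: ker) (simp add: kernel_def)
    then show ?thesis using b by blast
  qed
  have z: "x [^] n \<in> K"
  proof -
    obtain b a where b: "b \<in> K" "a \<in> Z" "y = a \<otimes> b"
      using lift[OF y] by blast
    then have bG: "b \<in> carrier G"
      using K subgroup.subset by blast
    have "y \<otimes> y = b \<otimes> b"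
    proof -
      \<comment> \<open>Elements of \<open>Z\<close> are central with trivial square, so passing
        from \<open>y\<close> to \<open>b\<close> does not change the square.\<close>
      have "a \<in> carrier G" "a \<otimes> a = \<one>" "b \<otimes> a = a \<otimes> b"
        using b(2) bG z_square z_central[OF bG] by (auto simp: Z_def)
      then show ?thesis
        using bG unfolding b(3) by (metis l_one m_assoc m_closed)
    qed
    then show ?thesis
      using b(1) K by (simp add: x_pow_n subgroup.m_closed)
  qed
  then have "Z \<subseteq> K"
    using K by (simp add: Z_def subgroup.one_closed)
  then show "carrier G \<subseteq> K"
    using lift K by (blast intro: subgroup.m_closed)
qed

text \<open>The first conjunct certifies that the cells do partition the vertices, as the notion of
  a quotient graph presupposes.\<close>

theorem theorem3p7:
  fixes n :: nat
  assumes "n > 1"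
  shows "partition_on (pverts (generating_graph (dicyclic_group n))) (Theta n) \<and>
    digraph_iso (with_proj (quotient_graph (generating_graph (dicyclic_group n)) (Theta n)))
      (with_proj (generating_graph (dihedral_group n)))"
proof -
  have "n > 0" using assms by simp
  interpret Q: dicyclic_pair "dicyclic_group n" n "dicyclic_x n" "dicyclic_y n"
    using \<open>n > 0\<close> by (rule dicyclic_pair_dicyclic_group)
  obtain h where h: "group_hom (dicyclic_group n) (dihedral_group n) h"
    and onto: "h ` carrier (dicyclic_group n) = carrier (dihedral_group n)"
    and ker: "kernel (dicyclic_group n) (dihedral_group n) h = Q.Z"
    using dicyclic_to_dihedral[OF \<open>n > 0\<close>] unfolding Q.Z_def by blast
  \<comment> \<open>Once the cells are recognised as the kernel cosets, both conjuncts are instances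
    of general facts on cosets.\<close>
  have Theta: "Theta n = rcosets\<^bsub>dicyclic_group n\<^esub> Q.Z"
    unfolding Theta_def Let_def Q.rcosets_Z_eq_cells ..
  have "partition_on (pverts (generating_graph (dicyclic_group n))) (Theta n)"
    using Q.partition_on_rcosets[OF Q.subgroup_Z] by (simp add: Theta generating_graph_def)
  moreover have "digraph_iso (with_proj (quotient_graph (generating_graph (dicyclic_group n)) (Theta n)))
      (with_proj (generating_graph (dihedral_group n)))"
    using group_hom.quotient_generating_graph_iso[OF h onto] Q.subgroup_onto_imp_whole[OF h ker]
    by (simp add: Theta ker)
  ultimately show ?thesis ..
qed

end
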